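(* Let $\rho$ be a symmetric measure on $(V\times V,\mathcal B\times\mathcal B)$, and let $A,B\in\mathcal B$ be any two sets with $\mu(A)<\infty$, $\mu(B)<\infty$. Then $$\rho_n(A\times B)=\langle\chi_A,P^n(\chi_B)\rangle_{L^2(\nu)}=\lambda(X_0\in A,\ X_n\in B),\qquad n\in\mathbb N.$$ Moreover, the Markov process $(P_n)$ is irreducible if and only if the measure $\rho$ is irreducible.
   Context: $(V,\mathcal B)$ is a standard Borel space, $\mu$ a non-atomic $\sigma$-finite measure. A symmetric measure $\rho$ is a $\sigma$-finite measure on $V\times V$ with $\rho(A\times B)=\rho(B\times A)$, disintegrated as $\iint f\,d\rho=\int_V\int_V f(x,y)\,d\rho_x(y)\,d\mu(x)$. Assume $0<c(x):=\rho_x(V)<\infty$ $\mu$-a.e. and $c\in L^1_{\mathrm{loc}}(\mu)$ (i.e. $\int_A c\,d\mu<\infty$ whenever $\mu(A)<\infty$). Set $d\nu=c\,d\mu$, $P(x,dy)=c(x)^{-1}d\rho_x(y)$, $P(f)(x)=\int_V f(y)P(x,dy)$, $P_1=P$, $P_{n+1}(x,A)=\int_V P_n(y,A)\,P(x,dy)$. The measures $\rho_n$ on $V\times V$ are given by $d\rho_n(x,y)=P_n(x,dy)\,d\nu(x)$ (so $\rho_1=\rho$). Path space: $\Omega=V^{\mathbb N_0}$ with the $\sigma$-algebra generated by cylinder sets, $X_n(\omega)=\omega_n$; $\mathbb P_x$ is the law on $\Omega_x=\{\omega:X_0(\omega)=x\}$ of the Markov chain started at $x$ with transition kernel $P$,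 i.e. $\mathbb P_x(X_1\in A_1,\dots,X_n\in A_n)=\int_{A_1}\cdots\int_{A_{n-1}}P(y_{n-1},A_n)P(y_{n-2},dy_{n-1})\cdots P(x,dy_1)$; and $\lambda=\int_V\mathbb P_x\,d\nu(x)$. A kernel $k(x,\cdot)$ has powers $k^1=k$, $k^n(x,A)=\int_V k^{n-1}(y,A)\,k(x,dy)$; it is $\mu$-irreducible if for any $A$ with $\mu(A)>0$ and $\mu$-a.e. $x\in V$ there is $n\ge1$ with $k^n(x,A)>0$. The measure $\rho$ is irreducible if the kernel $x\mapsto\rho_x(\cdot)$ is $\mu$-irreducible; the Markov process $(P_n)$ is irreducible if the kernel $x\mapsto P(x,\cdot)$ is $\mu$-irreducible. *)

theory Defs
  imports "HOL-Probability.Probability"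
begin

section \<open>Measures and kernels\<close>

definition standard_borel :: "'a measure \<Rightarrow> bool" where
  "standard_borel M \<longleftrightarrow>
     (\<exists>T. completely_metrizable_space T \<and> second_countable T \<and>
          topspace T = space M \<and> sets M = sigma_sets (topspace T) {U. openin T U})"

definition non_atomic :: "'a measure \<Rightarrow> bool" where
  "non_atomic M \<longleftrightarrow>
     (\<forall>A\<in>sets M. 0 < emeasure M A \<longrightarrow>
        (\<exists>B\<in>sets M. B \<subseteq> A \<and> 0 < emeasure M B \<and> emeasure M B < emeasure M A))"

definition symmetric_measure :: "'a measure \<Rightarrow> ('a \<times> 'a) measure \<Rightarrow> bool" where
  "symmetric_measure M \<rho> \<longleftrightarrow>
     sets \<rho> = sets (M \<Otimes>\<^sub>M M) \<and> sigma_finite_measure \<rho> \<and>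
     (\<forall>A\<in>sets M. \<forall>B\<in>sets M. emeasure \<rho> (A \<times> B) = emeasure \<rho> (B \<times> A))"

definition measure_kernel :: "'a measure \<Rightarrow> ('a \<Rightarrow> 'a measure) \<Rightarrow> bool" where
  "measure_kernel M k \<longleftrightarrow>
     (\<forall>x\<in>space M. sets (k x) = sets M) \<and>
     (\<forall>A\<in>sets M. (\<lambda>x. emeasure (k x) A) \<in> borel_measurable M)"

definition disintegration ::
  "'a measure \<Rightarrow> ('a \<times> 'a) measure \<Rightarrow> ('a \<Rightarrow> 'a measure) \<Rightarrow> bool" where
  "disintegration M \<rho> R \<longleftrightarrow>
     measure_kernel M R \<and>
     (\<forall>f\<in>borel_measurable (M \<Otimes>\<^sub>M M).
        (\<integral>\<^sup>+z. f z \<partial>\<rho>) = (\<integral>\<^sup>+x. \<integral>\<^sup>+y. f (x, y) \<partial>R x \<partial>M))"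

definition fibre_mass :: "'a measure \<Rightarrow> ('a \<Rightarrow> 'a measure) \<Rightarrow> 'a \<Rightarrow> ennreal" where
  "fibre_mass M R x = emeasure (R x) (space M)"

definition locally_L1 :: "'a measure \<Rightarrow> ('a \<Rightarrow> ennreal) \<Rightarrow> bool" where
  "locally_L1 M c \<longleftrightarrow>
     c \<in> borel_measurable M \<and>
     (\<forall>A\<in>sets M. emeasure M A < \<infinity> \<longrightarrow> (\<integral>\<^sup>+x\<in>A. c x \<partial>M) < \<infinity>)"

text \<open>Only the values at positive exponents matter below; the value at \<open>0\<close> is the
  identity kernel.\<close>

fun kernel_power :: "('a \<Rightarrow> 'a measure) \<Rightarrow> nat \<Rightarrow> 'a \<Rightarrow> 'a set \<Rightarrow> ennreal" where
  "kernel_power k 0 x A = indicator A x"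
| "kernel_power k (Suc 0) x A = emeasure (k x) A"
| "kernel_power k (Suc (Suc n)) x A = (\<integral>\<^sup>+y. kernel_power k (Suc n) y A \<partial>k x)"

definition irreducible_kernel :: "'a measure \<Rightarrow> ('a \<Rightarrow> 'a measure) \<Rightarrow> bool" where
  "irreducible_kernel M k \<longleftrightarrow>
     (\<forall>A\<in>sets M. 0 < emeasure M A \<longrightarrow> (AE x in M. \<exists>n\<ge>1. 0 < kernel_power k n x A))"

section \<open>The Markov process of a symmetric measure\<close>

text \<open>The formula \<open>c(x)\<^sup>-\<^sup>1 \<rho>\<^sub>x\<close> determines the transition kernel only where \<open>0 < c(x) < \<infinity>\<close>,
  which is almost everywhere. On the exceptional null set the kernel is taken to be
  the point mass at \<open>x\<close>, so that it is a Markov kernel everywhere and the path measure exists for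
  every starting point.\<close>

definition transition :: "'a measure \<Rightarrow> ('a \<Rightarrow> 'a measure) \<Rightarrow> 'a \<Rightarrow> 'a measure" where
  "transition M R x =
     (if 0 < fibre_mass M R x \<and> fibre_mass M R x < \<infinity>
      then scale_measure (inverse (fibre_mass M R x)) (R x)
      else return M x)"

definition nu :: "'a measure \<Rightarrow> ('a \<Rightarrow> 'a measure) \<Rightarrow> 'a measure" where
  "nu M R = density M (fibre_mass M R)"

definition rho_pow :: "'a measure \<Rightarrow> ('a \<Rightarrow> 'a measure) \<Rightarrow> nat \<Rightarrow> ('a \<times> 'a) measure" where
  "rho_pow M R n =
     measure_of (space (M \<Otimes>\<^sub>M M)) (sets (M \<Otimes>\<^sub>M M))
       (\<lambda>S. \<integral>\<^sup>+x. kernel_power (transition M R) n x (Pair x -` S) \<partial>nu M R)"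

definition kernel_op :: "('a \<Rightarrow> 'a measure) \<Rightarrow> ('a \<Rightarrow> real) \<Rightarrow> 'a \<Rightarrow> real" where
  "kernel_op k f x = (\<integral>y. f y \<partial>k x)"

definition L2 :: "'a measure \<Rightarrow> ('a \<Rightarrow> real) set" where
  "L2 N = {f \<in> borel_measurable N. integrable N (\<lambda>x. (f x)\<^sup>2)}"

definition L2_inner :: "'a measure \<Rightarrow> ('a \<Rightarrow> real) \<Rightarrow> ('a \<Rightarrow> real) \<Rightarrow> real" where
  "L2_inner N f g = (\<integral>x. f x * g x \<partial>N)"

section \<open>Path space\<close>

definition path_space :: "'a measure \<Rightarrow> (nat \<Rightarrow> 'a) measure" where
  "path_space M = PiM UNIV (\<lambda>_. M)"

text \<open>The law of the Markov chain started at \<open>x\<close> with Markov kernel \<open>k\<close>, obtained from the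
  Ionescu-Tulcea construction for a start in \<open>x\<close> followed by steps
  \<open>\<omega>\<^sub>i \<sim> k \<omega>\<^sub>i\<^sub>-\<^sub>1\<close>. The facts \<open>AE_path_law_start\<close> and \<open>emeasure_path_law_cylinder\<close> below
  confirm that it is carried by the paths starting at \<open>x\<close> and has the usual iterated integrals as
  cylinder probabilities.\<close>

definition path_step ::
  "'a measure \<Rightarrow> ('a \<Rightarrow> 'a measure) \<Rightarrow> 'a \<Rightarrow> nat \<Rightarrow> (nat \<Rightarrow> 'a) \<Rightarrow> 'a measure" where
  "path_step M k x i \<omega> = (if i = 0 then return M x else k (\<omega> (i - 1)))"

definition path_law ::
  "'a measure \<Rightarrow> ('a \<Rightarrow> 'a measure) \<Rightarrow> 'a \<Rightarrow> (nat \<Rightarrow> 'a) measure" where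
  "path_law M k x =
     projective_family.lim UNIV (Ionescu_Tulcea.CI (path_step M k x) (\<lambda>_. M)) (\<lambda>_. M)"

definition path_measure :: "'a measure \<Rightarrow> ('a \<Rightarrow> 'a measure) \<Rightarrow> (nat \<Rightarrow> 'a) measure" where
  "path_measure M R = nu M R \<bind> path_law M (transition M R)"

text \<open>\<open>cylinder_prob k A n x\<close> is the iterated integral
  \<open>\<integral>\<^bsub>A 0\<^esub> \<dots> \<integral>\<^bsub>A (n-1)\<^esub> k(y\<^sub>n\<^sub>-\<^sub>1, dy\<^sub>n) \<dots> k(x, dy\<^sub>1)\<close>.\<close>

primrec cylinder_prob ::
  "('a \<Rightarrow> 'a measure) \<Rightarrow> (nat \<Rightarrow> 'a set) \<Rightarrow> nat \<Rightarrow> 'a \<Rightarrow> ennreal" where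
  "cylinder_prob k A 0 x = 1"
| "cylinder_prob k A (Suc n) x =
     (\<integral>\<^sup>+y. indicator (A 0) y * cylinder_prob k (\<lambda>i. A (Suc i)) n y \<partial>k x)"

section \<open>Well-definedness\<close>

lemma measurable_transition:
  assumes "measure_kernel M R"
  shows "transition M R \<in> M \<rightarrow>\<^sub>M prob_algebra M"
proof (rule measurable_prob_algebra_generated[where \<Omega>="space M" and G="sets M"])
  show "sets M = sigma_sets (space M) (sets M)"
    by (simp add: sets.sigma_sets_eq)
  show "Int_stable (sets M)" by (auto simp: Int_stable_def)
  show "sets M \<subseteq> Pow (space M)" by (rule sets.space_closed)
  have sets_R: "sets (R x) = sets M" if "x \<in> space M" for x
    using assms that by (auto simp: measure_kernel_def)
  have [measurable]: "(\<lambda>x. emeasure (R x) A) \<in> borel_measurable M" if "A \<in> sets M" for A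
    using assms that by (auto simp: measure_kernel_def)
  have [measurable]: "fibre_mass M R \<in> borel_measurable M"
    unfolding fibre_mass_def by measurable
  fix x assume x: "x \<in> space M"
  show "sets (transition M R x) = sets M"
    by (simp add: transition_def sets_R x)
  show "prob_space (transition M R x)"
  proof (cases "0 < fibre_mass M R x \<and> fibre_mass M R x < \<infinity>")
    case True
    have "space (R x) = space M" using sets_R[OF x] by (rule sets_eq_imp_space_eq)
    with True show ?thesis
      by (intro prob_spaceI)
        (auto simp: transition_def space_scale_measure fibre_mass_def less_top
          mult.commute[of "inverse _"] simp flip: divide_ennreal_def intro!: ennreal_divide_self)
  next
    case False
    then show ?thesis using x by (auto simp: transition_def intro!: prob_space_return)
  qed
next
  fix A assume A[measurable]: "A \<in> sets M"
  have [measurable]: "(\<lambda>x. emeasure (R x) A) \<in> borel_measurable M" if "A \<in> sets M" for A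
    using assms that by (auto simp: measure_kernel_def)
  have [measurable]: "fibre_mass M R \<in> borel_measurable M"
    unfolding fibre_mass_def by measurable
  have "(\<lambda>x. if 0 < fibre_mass M R x \<and> fibre_mass M R x < \<infinity>
      then inverse (fibre_mass M R x) * emeasure (R x) A else indicator A x)
      \<in> borel_measurable M"
    by measurable
  also have "?this \<longleftrightarrow> (\<lambda>x. emeasure (transition M R x) A) \<in> borel_measurable M"
    by (intro measurable_cong) (auto simp: transition_def)
  finally show "(\<lambda>x. emeasure (transition M R x) A) \<in> borel_measurable M" .
qed

lemma kernel_power_kernel:
  assumes k[measurable]: "k \<in> M \<rightarrow>\<^sub>M prob_algebra M"
  shows "\<exists>q. q \<in> M \<rightarrow>\<^sub>M prob_algebra M \<and>
    (\<forall>x\<in>space M. \<forall>A\<in>sets M. kernel_power k n x A = emeasure (q x) A)"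
proof (induction n)
  case 0
  then show ?case
    by (intro exI[of _ "return M"]) auto
next
  case (Suc n)
  show ?case
  proof (cases n)
    case 0
    then show ?thesis by (intro exI[of _ k]) auto
  next
    case (Suc m)
    obtain q where q[measurable]: "q \<in> M \<rightarrow>\<^sub>M prob_algebra M"
      and eq: "\<And>x A. x \<in> space M \<Longrightarrow> A \<in> sets M \<Longrightarrow> kernel_power k n x A = emeasure (q x) A"
      using Suc.IH by blast
    have q': "q \<in> M \<rightarrow>\<^sub>M subprob_algebra M" and k': "k \<in> M \<rightarrow>\<^sub>M subprob_algebra M"
      by (auto intro: measurable_prob_algebraD)
    have "kernel_power k (Suc n) x A = emeasure (k x \<bind> q) A"
      if x: "x \<in> space M" and A: "A \<in> sets M" for x A
    proof -
      have sp: "space (k x) = space M" and st: "sets (k x) = sets M"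
        using subprob_measurableD[OF k' x] by auto
      have "emeasure (k x \<bind> q) A = (\<integral>\<^sup>+y. emeasure (q y) A \<partial>k x)"
        using x q' A sp st by (intro emeasure_bind) (auto cong: measurable_cong_sets)
      also have "\<dots> = (\<integral>\<^sup>+y. kernel_power k n y A \<partial>k x)"
        using A sp by (intro nn_integral_cong) (simp add: eq)
      finally show ?thesis by (simp add: Suc)
    qed
    moreover have "(\<lambda>x. k x \<bind> q) \<in> M \<rightarrow>\<^sub>M prob_algebra M"
      by measurable
    ultimately show ?thesis by blast
  qed
qed

lemma sets_rho_pow [simp]: "sets (rho_pow M R n) = sets (M \<Otimes>\<^sub>M M)"
  unfolding rho_pow_def by (simp add: sets.space_closed sets.sigma_sets_eq)

lemma emeasure_rho_pow:
  assumes R: "measure_kernel M R" and S: "S \<in> sets (M \<Otimes>\<^sub>M M)"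
  shows "emeasure (rho_pow M R n) S =
    (\<integral>\<^sup>+x. kernel_power (transition M R) n x (Pair x -` S) \<partial>nu M R)"
proof -
  let ?N = "nu M R"
  have [simp]: "space ?N = space M" "sets ?N = sets M" by (auto simp: nu_def)
  obtain q where q: "q \<in> M \<rightarrow>\<^sub>M prob_algebra M"
    and eq: "\<And>x A. x \<in> space M \<Longrightarrow> A \<in> sets M \<Longrightarrow>
      kernel_power (transition M R) n x A = emeasure (q x) A"
    using kernel_power_kernel[OF measurable_transition[OF R]] by blast
  have q': "q \<in> M \<rightarrow>\<^sub>M subprob_algebra M" using q by (rule measurable_prob_algebraD)
  have setsq: "sets (q x) = sets M" if "x \<in> space M" for x
    using subprob_measurableD[OF q' that] by simp
  have meas: "(\<lambda>x. emeasure (q x) (Pair x -` S)) \<in> borel_measurable ?N"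
    if S: "S \<in> sets (M \<Otimes>\<^sub>M M)" for S
  proof -
    have "(\<lambda>x. emeasure (q x) (Pair x -` S)) \<in> borel_measurable M"
    proof (rule emeasure_measurable_subprob_algebra2[OF _ q'])
      have "(SIGMA x:space M. Pair x -` S) = S"
        using sets.sets_into_space[OF S] by (auto simp: space_pair_measure)
      then show "(SIGMA x:space M. Pair x -` S) \<in> sets (M \<Otimes>\<^sub>M M)" using S by simp
    qed
    then show ?thesis by (simp add: nu_def)
  qed
  let ?f = "\<lambda>S. \<integral>\<^sup>+x. kernel_power (transition M R) n x (Pair x -` S) \<partial>?N"
  have f: "?f S = (\<integral>\<^sup>+x. emeasure (q x) (Pair x -` S) \<partial>?N)" if "S \<in> sets (M \<Otimes>\<^sub>M M)" for S
    using that by (intro nn_integral_cong) (auto simp: eq intro!: sets_Pair1)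
  show ?thesis
  proof (rule emeasure_measure_of[OF rho_pow_def])
    show "positive (sets (rho_pow M R n)) ?f"
      using f[of "{}"] by (simp add: positive_def)
    show "countably_additive (sets (rho_pow M R n)) ?f"
    proof (rule countably_additiveI)
      fix S :: "nat \<Rightarrow> _"
      assume *: "range S \<subseteq> sets (rho_pow M R n)" "disjoint_family S"
        "(\<Union>i. S i) \<in> sets (rho_pow M R n)"
      have S: "S i \<in> sets (M \<Otimes>\<^sub>M M)" for i using * by auto
      have "(\<Sum>i. ?f (S i)) = (\<Sum>i. \<integral>\<^sup>+x. emeasure (q x) (Pair x -` S i) \<partial>?N)"
        by (simp add: f S)
      also have "\<dots> = (\<integral>\<^sup>+x. (\<Sum>i. emeasure (q x) (Pair x -` S i)) \<partial>?N)"
        by (intro nn_integral_suminf[symmetric] meas S)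
      also have "\<dots> = (\<integral>\<^sup>+x. emeasure (q x) (Pair x -` (\<Union>i. S i)) \<partial>?N)"
      proof (intro nn_integral_cong)
        fix x assume "x \<in> space ?N"
        then have "range (\<lambda>i. Pair x -` S i) \<subseteq> sets (q x)"
          using S by (auto simp: setsq intro!: sets_Pair1)
        moreover have "disjoint_family (\<lambda>i. Pair x -` S i)"
          using *(2) by (auto simp: disjoint_family_on_def)
        ultimately show "(\<Sum>i. emeasure (q x) (Pair x -` S i)) = emeasure (q x) (Pair x -` (\<Union>i. S i))"
          by (simp add: suminf_emeasure vimage_UN)
      qed
      also have "\<dots> = ?f (\<Union>i. S i)" using *(3) by (simp add: f)
      finally show "(\<Sum>i. ?f (S i)) = ?f (\<Union>i. S i)" .
    qed
  qed (use S in \<open>auto simp: sets.space_closed\<close>)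
qed

lemma Ionescu_Tulcea_path_step:
  assumes k: "k \<in> M \<rightarrow>\<^sub>M prob_algebra M" and x: "x \<in> space M"
  shows "Ionescu_Tulcea (path_step M k x) (\<lambda>_. M)"
proof -
  have k': "k \<in> M \<rightarrow>\<^sub>M subprob_algebra M" using k by (rule measurable_prob_algebraD)
  have comp: "(\<lambda>\<omega>. \<omega> (i - 1)) \<in> PiM {0..<i} (\<lambda>_. M) \<rightarrow>\<^sub>M M" if "i \<noteq> 0" for i :: nat
    using that by (intro measurable_component_singleton) simp
  have 1: "path_step M k x i \<in> PiM {0..<i} (\<lambda>_. M) \<rightarrow>\<^sub>M subprob_algebra M" for i
  proof (cases "i = 0")
    case True
    then show ?thesis using x unfolding path_step_def
      by (simp add: measurable_compose[OF measurable_const return_measurable])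
  next
    case False
    then show ?thesis unfolding path_step_def
      using measurable_compose[OF comp[OF False] k'] by simp
  qed
  have 2: "prob_space (path_step M k x i \<omega>)" if \<omega>: "\<omega> \<in> space (PiM {0..<i} (\<lambda>_. M))" for i \<omega>
  proof (cases "i = 0")
    case True then show ?thesis using x by (simp add: path_step_def prob_space_return)
  next
    case False
    then have "\<omega> (i - 1) \<in> space M" using measurable_space[OF comp \<omega>] by simp
    with k have "k (\<omega> (i - 1)) \<in> space (prob_algebra M)" by (rule measurable_space)
    with False show ?thesis by (simp add: path_step_def space_prob_algebra)
  qed
  show ?thesis by (rule Ionescu_Tulcea.intro[OF 1 2])
qed

context
  fixes M :: "'a measure" and k :: "'a \<Rightarrow> 'a measure"
  assumes k: "k \<in> M \<rightarrow>\<^sub>M prob_algebra M"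
begin

lemma measurable_cylinder_prob:
  assumes "\<And>i. A i \<in> sets M"
  shows "cylinder_prob k A n \<in> borel_measurable M"
  using assms
proof (induction n arbitrary: A)
  case (Suc n)
  have [measurable]: "k \<in> M \<rightarrow>\<^sub>M subprob_algebra M" using k by (rule measurable_prob_algebraD)
  have [measurable]: "cylinder_prob k (\<lambda>i. A (Suc i)) n \<in> borel_measurable M"
    by (intro Suc.IH Suc.prems)
  have [measurable]: "A 0 \<in> sets M" by (rule Suc.prems)
  show ?case
    unfolding cylinder_prob.simps(2)[abs_def]
    by (rule measurable_compose[OF _ nn_integral_measurable_subprob_algebra]) measurable
qed (simp add: cylinder_prob.simps(1)[abs_def])

context
  fixes x :: 'a
  assumes x: "x \<in> space M"
begin

interpretation IT: Ionescu_Tulcea "path_step M k x" "\<lambda>_. M"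
  using k x by (rule Ionescu_Tulcea_path_step)

lemma path_law_eq: "path_law M k x = IT.PF.lim"
  by (simp add: path_law_def)

lemma sets_path_law: "sets (path_law M k x) = sets (path_space M)"
  by (simp add: path_law_eq path_space_def)

lemma prob_space_path_law: "prob_space (path_law M k x)"
  unfolding path_law_eq
  by (rule prob_space_distrD[where M=IT.PF.lim and N="PiM {} (\<lambda>_. M)" and f="\<lambda>f. restrict f {}"])
     (auto simp: IT.distr_lim measurable_cong_sets[OF IT.PF.sets_lim refl]
       intro!: IT.PF.prob_space_P measurable_restrict_subset)

lemma path_chain_cylinder:
  assumes B: "B \<in> sets M" and A: "\<And>i. A i \<in> sets M"
    and \<omega>: "\<omega> \<in> space (PiM {0..<Suc n} (\<lambda>_. M))"
  shows "emeasure (IT.C (Suc n) m \<omega>)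
      {\<omega>'\<in>space (PiM {0..<Suc n + m} (\<lambda>_. M)). (\<forall>i<m. \<omega>' (Suc n + i) \<in> A i) \<and> \<omega>' 0 \<in> B}
    = (if \<omega> 0 \<in> B then cylinder_prob k A m (\<omega> n) else 0)"
  using A \<omega>
proof (induction m arbitrary: n \<omega> A)
  case 0
  have "{\<omega>'\<in>space (PiM {0..<Suc n} (\<lambda>_. M)). \<omega>' 0 \<in> B} \<in> sets (PiM {0..<Suc n} (\<lambda>_. M))"
    using B by measurable
  with 0 show ?case by (auto simp: indicator_def)
next
  case (Suc m)
  let ?\<Omega> = "\<lambda>n. PiM {0..<n} (\<lambda>_. M)"
  let ?S = "{\<omega>'\<in>space (?\<Omega> (Suc n + Suc m)). (\<forall>i<Suc m. \<omega>' (Suc n + i) \<in> A i) \<and> \<omega>' 0 \<in> B}"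
  let ?T = "{\<omega>'\<in>space (?\<Omega> (Suc (Suc n) + m)).
     (\<forall>i<m. \<omega>' (Suc (Suc n) + i) \<in> A (Suc i)) \<and> \<omega>' 0 \<in> B}"
  note [measurable] = Suc.prems(1) B
  have S: "?S \<in> sets (?\<Omega> (Suc n + Suc m))"
    by measurable
  have \<omega>n: "\<omega> n \<in> space M" and \<omega>0: "\<omega> 0 \<in> space M"
    using Suc.prems(2) by (auto simp: space_PiM PiE_iff)
  have sp: "space (k (\<omega> n)) = space M" "sets (k (\<omega> n)) = sets M"
    using measurable_prob_algebraD[OF k] \<omega>n by (auto dest: subprob_measurableD)
  have mC: "IT.C (Suc (Suc n)) m \<in> ?\<Omega> (Suc (Suc n)) \<rightarrow>\<^sub>M subprob_algebra (?\<Omega> (Suc n + Suc m))"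
    using IT.measurable_C[of "Suc (Suc n)" m] by simp
  have 1: "IT.C (Suc n) 1 \<omega> = IT.eP (Suc n) \<omega>"
    using Suc.prems(2) by (simp add: bind_return[OF IT.measurable_eP])
  have "IT.C (Suc n) (Suc m) \<omega> = IT.eP (Suc n) \<omega> \<bind> IT.C (Suc (Suc n)) m"
    using IT.split_C[OF Suc.prems(2), of 1 m] unfolding 1 by simp
  then have "emeasure (IT.C (Suc n) (Suc m) \<omega>) ?S
      = (\<integral>\<^sup>+\<omega>'. emeasure (IT.C (Suc (Suc n)) m \<omega>') ?S \<partial>IT.eP (Suc n) \<omega>)"
    using mC S Suc.prems(2) prob_space.not_empty[OF IT.prob_space_eP[OF Suc.prems(2)]]
    by (simp only:, intro emeasure_bind)
       (auto simp: measurable_cong_sets[OF IT.sets_eP[OF Suc.prems(2)] refl])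
  also have "\<dots> = (\<integral>\<^sup>+y. emeasure (IT.C (Suc (Suc n)) m (fun_upd \<omega> (Suc n) y)) ?S \<partial>path_step M k x (Suc n) \<omega>)"
    using Suc.prems(2) measurable_emeasure_kernel[OF mC S] by (rule IT.nn_integral_eP)
  also have "\<dots> = (\<integral>\<^sup>+y. emeasure (IT.C (Suc (Suc n)) m (fun_upd \<omega> (Suc n) y)) ?S \<partial>k (\<omega> n))"
    by (simp add: path_step_def)
  also have "\<dots> = (\<integral>\<^sup>+y. (if \<omega> 0 \<in> B then 1 else 0) *
      (indicator (A 0) y * cylinder_prob k (\<lambda>i. A (Suc i)) m y) \<partial>k (\<omega> n))"
  proof (intro nn_integral_cong)
    fix y assume "y \<in> space (k (\<omega> n))"
    then have y: "y \<in> space M" by (simp add: sp)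
    define \<omega>' where "\<omega>' = fun_upd \<omega> (Suc n) y"
    have \<omega>': "\<omega>' \<in> space (?\<Omega> (Suc (Suc n)))"
      using Suc.prems(2) y by (auto simp: \<omega>'_def space_PiM PiE_iff extensional_def)
    have AE: "AE \<omega>'' in IT.C (Suc (Suc n)) m \<omega>'. \<omega>'' \<in> ?S \<longleftrightarrow> y \<in> A 0 \<and> \<omega>'' \<in> ?T"
    proof -
      let ?Q = "\<lambda>\<omega>'' :: nat \<Rightarrow> 'a. \<omega>'' (Suc n) \<in> A 0 \<longleftrightarrow> y \<in> A 0"
      have Q: "Measurable.pred (?\<Omega> (Suc (Suc n))) ?Q"
        by measurable
      have "AE \<omega>'' in return (?\<Omega> (Suc (Suc n))) \<omega>'. ?Q \<omega>''"
        using \<omega>' Q by (subst AE_return) (auto simp: \<omega>'_def)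
      then have "AE \<omega>'' in IT.C (Suc (Suc n)) 0 \<omega>'. ?Q \<omega>''"
        unfolding IT.C.simps .
      also have "IT.C (Suc (Suc n)) 0 \<omega>' = distr (IT.C (Suc (Suc n)) m \<omega>')
          (?\<Omega> (Suc (Suc n) + 0)) (\<lambda>x. restrict x {0..<Suc (Suc n) + 0})"
        using \<omega>' by (intro IT.distr_C) auto
      finally have "AE \<omega>'' in IT.C (Suc (Suc n)) m \<omega>'. ?Q (restrict \<omega>'' {0..<Suc (Suc n)})"
        by (subst (asm) AE_distr_iff)
           (use Q \<omega>' in \<open>auto simp: measurable_cong_sets[OF IT.sets_C[OF \<omega>'] refl]
              intro!: measurable_restrict_subset\<close>)
      then show ?thesis
      proof (rule AE_mp, intro AE_I2 impI)
        fix \<omega>'' assume "\<omega>'' \<in> space (IT.C (Suc (Suc n)) m \<omega>')"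
          and "?Q (restrict \<omega>'' {0..<Suc (Suc n)})"
        then show "\<omega>'' \<in> ?S \<longleftrightarrow> y \<in> A 0 \<and> \<omega>'' \<in> ?T"
          by (auto simp: All_less_Suc2)
      qed
    qed
    have T: "?T \<in> sets (?\<Omega> (Suc (Suc n) + m))" by measurable
    have "emeasure (IT.C (Suc (Suc n)) m \<omega>') ?S
        = emeasure (IT.C (Suc (Suc n)) m \<omega>') (if y \<in> A 0 then ?T else {})"
      using AE S T IT.sets_C[OF \<omega>', of m]
      by (intro emeasure_eq_AE) auto
    also have "\<dots> = indicator (A 0) y * emeasure (IT.C (Suc (Suc n)) m \<omega>') ?T"
      by auto
    also have "emeasure (IT.C (Suc (Suc n)) m \<omega>') ?T
        = (if \<omega>' 0 \<in> B then cylinder_prob k (\<lambda>i. A (Suc i)) m (\<omega>' (Suc n)) else 0)"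
      by (rule Suc.IH[OF _ \<omega>']) (rule Suc.prems)
    finally have "emeasure (IT.C (Suc (Suc n)) m \<omega>') ?S = indicator (A 0) y *
        (if \<omega>' 0 \<in> B then cylinder_prob k (\<lambda>i. A (Suc i)) m (\<omega>' (Suc n)) else 0)" .
    moreover have "\<omega>' 0 = \<omega> 0" "\<omega>' (Suc n) = y" by (auto simp: \<omega>'_def)
    ultimately show "emeasure (IT.C (Suc (Suc n)) m (fun_upd \<omega> (Suc n) y)) ?S =
        (if \<omega> 0 \<in> B then 1 else 0) * (indicator (A 0) y * cylinder_prob k (\<lambda>i. A (Suc i)) m y)"
      unfolding \<omega>'_def[symmetric] by simp
  qed
  also have "\<dots> = (if \<omega> 0 \<in> B then cylinder_prob k A (Suc m) (\<omega> n) else 0)"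
    by simp
  finally show ?case .
qed

lemma emeasure_path_law:
  assumes A: "\<And>i. A i \<in> sets M" and B: "B \<in> sets M"
  shows "emeasure (path_law M k x)
      {\<omega>\<in>space (path_space M). (\<forall>i<n. \<omega> (Suc i) \<in> A i) \<and> \<omega> 0 \<in> B}
    = indicator B x * cylinder_prob k A n x"
proof -
  let ?\<Omega> = "\<lambda>n. PiM {0..<n} (\<lambda>_. M)"
  let ?S = "{\<omega>\<in>space (?\<Omega> (Suc n)). (\<forall>i<n. \<omega> (Suc i) \<in> A i) \<and> \<omega> 0 \<in> B}"
  note [measurable] = A B
  have S: "?S \<in> sets (?\<Omega> (Suc n))" by measurable
  have "{\<omega>\<in>space (path_space M). (\<forall>i<n. \<omega> (Suc i) \<in> A i) \<and> \<omega> 0 \<in> B}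
      = prod_emb UNIV (\<lambda>_. M) {0..<Suc n} ?S"
    by (auto simp: prod_emb_def path_space_def space_PiM PiE_iff)
  then have "emeasure (path_law M k x) {\<omega>\<in>space (path_space M). (\<forall>i<n. \<omega> (Suc i) \<in> A i) \<and> \<omega> 0 \<in> B}
      = emeasure (IT.CI {0..<Suc n}) ?S"
    using S by (simp add: path_law_eq IT.lim del: prod_emb_def)
  also have "\<dots> = emeasure (IT.C 0 (Suc n) (\<lambda>_. undefined)) ?S"
    using IT.emeasure_CI[of "{0..<Suc n}" "Suc n" ?S] S
      prod_emb_id[of ?S "{0..<Suc n}" "\<lambda>_. M"] by (simp add: space_PiM del: IT.C.simps)
  also have "IT.C 0 (Suc n) (\<lambda>_. undefined) = IT.eP 0 (\<lambda>_. undefined) \<bind> IT.C (Suc 0) n"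
  proof -
    have "IT.C 0 (Suc 0) (\<lambda>_. undefined) = IT.eP 0 (\<lambda>_. undefined)"
      unfolding IT.C.simps using bind_return[OF IT.measurable_eP, of "\<lambda>_. undefined" 0]
      by (simp add: space_PiM)
    then show ?thesis
      using IT.split_C[of "\<lambda>_. undefined" 0 "Suc 0" n]
      by (simp add: space_PiM del: IT.C.simps)
  qed
  also have "emeasure \<dots> ?S = (\<integral>\<^sup>+\<omega>. emeasure (IT.C (Suc 0) n \<omega>) ?S \<partial>IT.eP 0 (\<lambda>_. undefined))"
  proof (rule emeasure_bind)
    show "space (IT.eP 0 (\<lambda>_. undefined)) \<noteq> {}"
      by (intro prob_space.not_empty IT.prob_space_eP) (simp add: space_PiM)
    show "IT.C (Suc 0) n \<in> IT.eP 0 (\<lambda>_. undefined) \<rightarrow>\<^sub>M subprob_algebra (?\<Omega> (Suc n))"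
      using IT.measurable_C[of "Suc 0" n]
      by (subst measurable_cong_sets[OF IT.sets_eP refl]) (auto simp: space_PiM)
  qed (rule S)
  also have "\<dots> = (\<integral>\<^sup>+y. emeasure (IT.C (Suc 0) n (fun_upd (\<lambda>_. undefined) 0 y)) ?S \<partial>return M x)"
  proof (subst IT.nn_integral_eP)
    show "(\<lambda>\<omega>. emeasure (IT.C (Suc 0) n \<omega>) ?S) \<in> borel_measurable (?\<Omega> (Suc 0))"
      using S IT.measurable_C[of "Suc 0" n] by (intro measurable_emeasure_kernel[of _ _ "?\<Omega> (Suc n)"]) simp_all
  qed (auto simp: space_PiM path_step_def)
  also have "\<dots> = (\<integral>\<^sup>+y. indicator B y * cylinder_prob k A n y \<partial>return M x)"
  proof (intro nn_integral_cong)
    fix y assume "y \<in> space (return M x)"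
    then have "fun_upd (\<lambda>_. undefined) 0 y \<in> space (?\<Omega> (Suc 0))"
      by (auto simp: space_PiM PiE_iff extensional_def)
    from path_chain_cylinder[where A=A and m=n, OF B A this]
    show "emeasure (IT.C (Suc 0) n (fun_upd (\<lambda>_. undefined) 0 y)) ?S = indicator B y * cylinder_prob k A n y"
      by simp
  qed
  also have "\<dots> = indicator B x * cylinder_prob k A n x"
    using x measurable_cylinder_prob[OF A] by (subst nn_integral_return) auto
  finally show ?thesis .
qed

lemma emeasure_path_law_cylinder:
  assumes A: "\<And>i. A i \<in> sets M"
  shows "emeasure (path_law M k x) {\<omega>\<in>space (path_space M). \<forall>i<n. \<omega> (Suc i) \<in> A i}
    = cylinder_prob k A n x"
proof -
  have "{\<omega>\<in>space (path_space M). \<forall>i<n. \<omega> (Suc i) \<in> A i} =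
      {\<omega>\<in>space (path_space M). (\<forall>i<n. \<omega> (Suc i) \<in> A i) \<and> \<omega> 0 \<in> space M}"
    by (auto simp: path_space_def space_PiM)
  then show ?thesis using emeasure_path_law[OF A, of "space M" n] x by simp
qed

lemma AE_path_law_start:
  assumes "{x} \<in> sets M"
  shows "AE \<omega> in path_law M k x. \<omega> 0 = x"
proof -
  interpret prob_space "path_law M k x" by (rule prob_space_path_law)
  have "emeasure (path_law M k x) {\<omega>\<in>space (path_law M k x). \<omega> 0 = x} = 1"
    using emeasure_path_law[of "\<lambda>_. space M" "{x}" 0] assms
      sets_eq_imp_space_eq[OF sets_path_law] by simp
  moreover have "{\<omega>\<in>space (path_law M k x). \<omega> 0 = x} \<in> sets (path_law M k x)"
  proof -
    have "(\<lambda>\<omega>. \<omega> 0) -` {x} \<inter> space (path_space M) \<in> sets (path_space M)"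
      unfolding path_space_def
      using assms by (intro measurable_sets[OF measurable_component_singleton]) auto
    also have "(\<lambda>\<omega>. \<omega> 0) -` {x} \<inter> space (path_space M) =
        {\<omega>\<in>space (path_law M k x). \<omega> 0 = x}"
      using sets_eq_imp_space_eq[OF sets_path_law] by auto
    finally show ?thesis by (simp add: sets_path_law)
  qed
  ultimately have "AE \<omega> in path_law M k x. \<omega> \<in> {\<omega>\<in>space (path_law M k x). \<omega> 0 = x}"
    by (simp only: AE_in_set_eq_1 emeasure_eq_measure ennreal_eq_1)
  then show ?thesis by eventually_elim auto
qed

end

lemma measurable_path_law: "path_law M k \<in> M \<rightarrow>\<^sub>M prob_algebra (path_space M)"
proof -
  define G where "G = range (\<lambda>(n, A, B). {\<omega>\<in>space (path_space M).
      (\<forall>i<(n::nat). \<omega> (Suc i) \<in> (if A i \<in> sets M then A i else {})) \<and>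
      \<omega> 0 \<in> (if B \<in> sets M then B else {})})"
  have GI: "{\<omega>\<in>space (path_space M). (\<forall>i<n. \<omega> (Suc i) \<in> A i) \<and> \<omega> 0 \<in> B} \<in> G"
    if "\<And>i. A i \<in> sets M" "B \<in> sets M" for n A B
    unfolding G_def using that by (intro image_eqI[of _ _ "(n, A, B)"]) auto
  have GE: "\<exists>n A B. X = {\<omega>\<in>space (path_space M). (\<forall>i<n. \<omega> (Suc i) \<in> A i) \<and> \<omega> 0 \<in> B} \<and>
      (\<forall>i. A i \<in> sets M) \<and> B \<in> sets M" if "X \<in> G" for X
  proof -
    from that obtain t where t: "X = (case t of (n, A, B) \<Rightarrow> {\<omega>\<in>space (path_space M).
      (\<forall>i<(n::nat). \<omega> (Suc i) \<in> (if A i \<in> sets M then A i else {})) \<and>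
      \<omega> 0 \<in> (if B \<in> sets M then B else {})})"
      unfolding G_def by (rule imageE)
    obtain n A B where "t = (n, A, B)" by (cases t)
    with t have "X = {\<omega>\<in>space (path_space M).
      (\<forall>i<(n::nat). \<omega> (Suc i) \<in> (if A i \<in> sets M then A i else {})) \<and>
      \<omega> 0 \<in> (if B \<in> sets M then B else {})}"
      by simp
    then show ?thesis
      by (intro exI[of _ n] exI[of _ "\<lambda>i. if A i \<in> sets M then A i else {}"]
          exI[of _ "if B \<in> sets M then B else {}"]) auto
  qed
  have [measurable]: "(\<lambda>\<omega>. \<omega> i) \<in> path_space M \<rightarrow>\<^sub>M M" for i
    unfolding path_space_def by measurable
  have Gsets: "G \<subseteq> sets (path_space M)"
  proof
    fix X assume "X \<in> G"
    from GE[OF this] obtain n A B where X: "X = {\<omega>\<in>space (path_space M). (\<forall>i<n. \<omega> (Suc i) \<in> A i) \<and> \<omega> 0 \<in> B}"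
      and AB: "\<forall>i. A i \<in> sets M" "B \<in> sets M"
      by (elim exE conjE)
    have [measurable]: "A i \<in> sets M" "B \<in> sets M" for i using AB by auto
    show "X \<in> sets (path_space M)" unfolding X by measurable
  qed
  show ?thesis
  proof (rule measurable_prob_algebra_generated[where \<Omega>="space (path_space M)" and G=G])
    show "G \<subseteq> Pow (space (path_space M))"
      using Gsets sets.space_closed by blast
    show "Int_stable G"
    proof (rule Int_stableI)
      fix X Y assume "X \<in> G" "Y \<in> G"
      from GE[OF this(1)] obtain n A B where
        X: "X = {\<omega>\<in>space (path_space M). (\<forall>i<n. \<omega> (Suc i) \<in> A i) \<and> \<omega> 0 \<in> B}"
        and A: "\<forall>i. A i \<in> sets M" "B \<in> sets M"
        by (elim exE conjE)
      from GE[OF \<open>Y \<in> G\<close>] obtain n' A' B' where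
        Y: "Y = {\<omega>\<in>space (path_space M). (\<forall>i<n'. \<omega> (Suc i) \<in> A' i) \<and> \<omega> 0 \<in> B'}"
        and A': "\<forall>i. A' i \<in> sets M" "B' \<in> sets M"
        by (elim exE conjE)
      let ?A = "\<lambda>i. (if i < n then A i else space M) \<inter> (if i < n' then A' i else space M)"
      have "X \<inter> Y = {\<omega>\<in>space (path_space M).
          (\<forall>i<max n n'. \<omega> (Suc i) \<in> ?A i) \<and> \<omega> 0 \<in> B \<inter> B'}"
        unfolding X Y by (auto simp: path_space_def space_PiM less_max_iff_disj)
      also have "\<dots> \<in> G" using A A' by (intro GI) auto
      finally show "X \<inter> Y \<in> G" .
    qed
    show "sets (path_space M) = sigma_sets (space (path_space M)) G"
    proof
      show "sigma_sets (space (path_space M)) G \<subseteq> sets (path_space M)"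
        using Gsets by (rule sets.sigma_sets_subset)
      have "sets (path_space M) = sigma_sets (space (path_space M))
          {{\<omega>\<in>space (path_space M). \<omega> i \<in> A} | i A. i \<in> UNIV \<and> A \<in> sets M}"
        unfolding path_space_def by (subst sets_PiM_single) (simp add: space_PiM)
      also have "\<dots> \<subseteq> sigma_sets (space (path_space M)) G"
      proof (rule sigma_sets_mono', safe)
        fix i A assume A: "A \<in> sets M"
        show "{\<omega>\<in>space (path_space M). \<omega> i \<in> A} \<in> G"
        proof (cases i)
          case 0
          then show ?thesis using GI[of "\<lambda>_. space M" A 0] A by simp
        next
          case (Suc j)
          have "{\<omega>\<in>space (path_space M). \<omega> i \<in> A} = {\<omega>\<in>space (path_space M).
              (\<forall>l<Suc j. \<omega> (Suc l) \<in> (if l = j then A else space M)) \<and> \<omega> 0 \<in> space M}"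
            unfolding Suc by (auto simp: path_space_def space_PiM)
          also have "\<dots> \<in> G" using A by (intro GI) auto
          finally show ?thesis .
        qed
      qed
      finally show "sets (path_space M) \<subseteq> sigma_sets (space (path_space M)) G" .
    qed
  next
    fix X assume "X \<in> G"
    from GE[OF this] obtain n A B where X: "X = {\<omega>\<in>space (path_space M). (\<forall>i<n. \<omega> (Suc i) \<in> A i) \<and> \<omega> 0 \<in> B}"
      and A': "\<forall>i. A i \<in> sets M" and B[measurable]: "B \<in> sets M"
      by (elim exE conjE)
    have A: "A i \<in> sets M" for i using A' by simp
    have [measurable]: "cylinder_prob k A n \<in> borel_measurable M"
      using A by (rule measurable_cylinder_prob)
    have "(\<lambda>x. indicator B x * cylinder_prob k A n x) \<in> borel_measurable M"
      by measurable
    then show "(\<lambda>x. emeasure (path_law M k x) X) \<in> borel_measurable M"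
      by (subst measurable_cong) (auto simp: X emeasure_path_law[OF _ A B])
  qed (auto simp: sets_path_law intro: prob_space_path_law)
qed

end

lemma emeasure_path_measure:
  assumes R: "measure_kernel M R" and S: "S \<in> sets (path_space M)" and "space M \<noteq> {}"
  shows "emeasure (path_measure M R) S =
    (\<integral>\<^sup>+x. emeasure (path_law M (transition M R) x) S \<partial>nu M R)"
proof -
  have "path_law M (transition M R) \<in> nu M R \<rightarrow>\<^sub>M subprob_algebra (path_space M)"
    using measurable_prob_algebraD[OF measurable_path_law[OF measurable_transition[OF R]]]
    by (simp add: nu_def)
  then show ?thesis
    unfolding path_measure_def using assms by (intro emeasure_bind) (auto simp: nu_def)
qed

end

theory Submission
  imports Defs
begin

text \<open>Symmetry of \<open>\<rho>\<close> says that both marginals of \<open>\<rho>\<close> equal \<open>\<nu> = c \<mu>\<close>. Hence \<open>\<nu>\<close> is invariant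
  under \<open>P\<close>, which together with \<open>0 \<le> P\<^sup>n \<chi>\<^sub>B \<le> 1\<close> gives
  \<open>\<integral> (P\<^sup>n \<chi>\<^sub>B)\<^sup>2 d\<nu> \<le> \<nu>(B) < \<infinity>\<close>; all three quantities are then \<open>\<integral>\<^sub>A P\<^sub>n(x, B) d\<nu>(x)\<close>.
  The marginal identity also shows that for \<open>\<mu>\<close>-a.e. \<open>x\<close> the measure \<open>\<rho>\<^sub>x\<close> vanishes on a given
  \<open>\<mu>\<close>-null set. As \<open>P(x, \<cdot>)\<close> and \<open>\<rho>\<^sub>x\<close> have the same null sets a.e., induction on \<open>n\<close> shows
  that the \<open>n\<close>-th powers of the two kernels charge \<open>A\<close> from the same starting points up to a null
  set.\<close>

section \<open>Kernels, their powers, and iterates of the induced operator\<close>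

lemma kernel_power_Suc:
  assumes "A \<in> sets (k x)"
  shows "kernel_power k (Suc n) x A = (\<integral>\<^sup>+y. kernel_power k n y A \<partial>k x)"
  \<comment> \<open>Exponent 1 is a separate clause of \<open>kernel_power\<close>; it fits the
    uniform recursion because the integral of \<open>indicator A\<close> is
    \<open>emeasure (k x) A\<close> for measurable \<open>A\<close>. Inductions can then start at
    0.\<close>
  using assms by (cases n) auto

lemma measure_kernelD:
  assumes "measure_kernel M k"
  shows "x \<in> space M \<Longrightarrow> sets (k x) = sets M" "x \<in> space M \<Longrightarrow> space (k x) = space M"
    "A \<in> sets M \<Longrightarrow> (\<lambda>x. emeasure (k x) A) \<in> borel_measurable M"
  using assms by (auto simp: measure_kernel_def dest: sets_eq_imp_space_eq)

lemma measure_kernel_prob_algebra: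
  assumes [measurable]: "k \<in> M \<rightarrow>\<^sub>M prob_algebra M"
  shows "measure_kernel M k"
proof -
  have k: "k \<in> M \<rightarrow>\<^sub>M subprob_algebra M"
    by (rule measurable_prob_algebraD) fact
  then show ?thesis
    using subprob_measurableD(2)[OF k] by (auto simp: measure_kernel_def)
qed

text \<open>The mass of \<open>k x\<close> is unrestricted, so \<open>k\<close> need not map into
  \<open>subprob_algebra M\<close>. Measurability is carried from indicators through multiples, sums
  and monotone suprema.\<close>

lemma borel_measurable_nn_integral_measure_kernel:
  assumes k: "measure_kernel M k" and f: "f \<in> borel_measurable M"
  shows "(\<lambda>x. \<integral>\<^sup>+y. f y \<partial>k x) \<in> borel_measurable M"
  using f
proof (induction rule: borel_measurable_induct)
  case (cong f g)
  have "(\<integral>\<^sup>+y. f y \<partial>k x) = (\<integral>\<^sup>+y. g y \<partial>k x)" if "x \<in> space M" for x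
    using cong(3) measure_kernelD(2)[OF k that] by (intro nn_integral_cong) auto
  with cong(4) show ?case by (simp cong: measurable_cong)
next
  case (set A)
  have "(\<integral>\<^sup>+y. indicator A y \<partial>k x) = emeasure (k x) A" if "x \<in> space M" for x
    using set measure_kernelD(1)[OF k that] by simp
  with measure_kernelD(3)[OF k set] show ?case by (simp cong: measurable_cong)
next
  case (mult u c)
  have "(\<integral>\<^sup>+y. c * u y \<partial>k x) = c * (\<integral>\<^sup>+y. u y \<partial>k x)" if "x \<in> space M" for x
    using mult(2) measure_kernelD(1)[OF k that]
    by (intro nn_integral_cmult) (auto cong: measurable_cong_sets)
  with mult show ?case by (simp cong: measurable_cong)
next
  case (add u v)
  have "(\<integral>\<^sup>+y. v y + u y \<partial>k x) = (\<integral>\<^sup>+y. v y \<partial>k x) + (\<integral>\<^sup>+y. u y \<partial>k x)" if "x \<in> space M" for x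
    using add(1,3) measure_kernelD(1)[OF k that]
    by (intro nn_integral_add) (auto cong: measurable_cong_sets)
  with add show ?case by (simp cong: measurable_cong)
next
  case (seq U)
  have "(\<integral>\<^sup>+y. (SUP i. U i) y \<partial>k x) = (SUP i. \<integral>\<^sup>+y. U i y \<partial>k x)" if "x \<in> space M" for x
    unfolding SUP_apply using seq(1,3) measure_kernelD(1)[OF k that]
    by (intro nn_integral_monotone_convergence_SUP) (auto cong: measurable_cong_sets)
  with seq show ?case by (simp cong: measurable_cong)
qed

lemma borel_measurable_kernel_power:
  assumes k: "measure_kernel M k" and A: "A \<in> sets M"
  shows "(\<lambda>x. kernel_power k n x A) \<in> borel_measurable M"
proof (induction n)
  case 0
  with A show ?case by simp
next
  case (Suc n)
  then show ?case
    using borel_measurable_nn_integral_measure_kernel[OF k Suc] A measure_kernelD(1)[OF k]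
    by (simp add: kernel_power_Suc cong: measurable_cong)
qed

lemma kernel_power_le_1:
  assumes "k \<in> M \<rightarrow>\<^sub>M prob_algebra M" and "x \<in> space M" "A \<in> sets M"
  shows "kernel_power k n x A \<le> 1"
proof -
  obtain q where q: "q \<in> M \<rightarrow>\<^sub>M prob_algebra M"
    and eq: "\<And>x A. x \<in> space M \<Longrightarrow> A \<in> sets M \<Longrightarrow> kernel_power k n x A = emeasure (q x) A"
    using kernel_power_kernel[OF assms(1), of n] by blast
  have "prob_space (q x)"
    using measurable_space[OF q assms(2)] by (simp add: space_prob_algebra)
  then show ?thesis
    using assms by (simp add: eq prob_space.emeasure_le_1)
qed

lemma ennreal_enn2real_kernel_power:
  assumes "k \<in> M \<rightarrow>\<^sub>M prob_algebra M" and "x \<in> space M" "A \<in> sets M"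
  shows "ennreal (enn2real (kernel_power k n x A)) = kernel_power k n x A"
  using order.strict_trans1[OF kernel_power_le_1[OF assms] ennreal_one_less_top]
  by (simp add: less_top)

lemma kernel_power_empty: "kernel_power k (Suc n) x {} = 0"
  by (induction n arbitrary: x) auto

text \<open>Links the real operator, built on the Bochner integral, with the extended nonnegative
  powers. Powers of a Markov kernel are at most 1, so \<open>enn2real\<close> loses nothing and both
  sides obey the same recursion.\<close>

lemma kernel_op_power_indicator:
  assumes k: "k \<in> M \<rightarrow>\<^sub>M prob_algebra M" and x: "x \<in> space M" and A: "A \<in> sets M"
  shows "(kernel_op k ^^ n) (indicator A) x = enn2real (kernel_power k n x A)"
  using x
proof (induction n arbitrary: x)
  case 0
  then show ?case by (simp add: indicator_def)
next
  case (Suc n)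
  note mk = measure_kernel_prob_algebra[OF k]
  note sets_kx = measure_kernelD(1,2)[OF mk Suc.prems]
  have "(kernel_op k ^^ Suc n) (indicator A) x = (\<integral>y. enn2real (kernel_power k n y A) \<partial>k x)"
    \<comment> \<open>Only the outermost application is unfolded, so the induction hypothesis still
      matches the inner iterate.\<close>
    unfolding funpow.simps o_apply kernel_op_def[of k "(kernel_op k ^^ n) (indicator A)"]
    using Suc.IH sets_kx by (intro Bochner_Integration.integral_cong) auto
  also have "\<dots> = enn2real (\<integral>\<^sup>+y. ennreal (enn2real (kernel_power k n y A)) \<partial>k x)"
    using borel_measurable_kernel_power[OF mk A] sets_kx
    by (intro integral_eq_nn_integral) (auto cong: measurable_cong_sets)
  also have "(\<integral>\<^sup>+y. ennreal (enn2real (kernel_power k n y A)) \<partial>k x)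
      = (\<integral>\<^sup>+y. kernel_power k n y A \<partial>k x)"
    using sets_kx by (intro nn_integral_cong) (simp add: ennreal_enn2real_kernel_power[OF k _ A])
  finally show ?case
    using A sets_kx by (simp add: kernel_power_Suc)
qed

text \<open>Index \<open>i\<close> of the set sequence constrains the state at time
  \<open>i + 1\<close>, so this is the event of being in \<open>A\<close> at time
  \<open>n + 1\<close>. Each unrestricted coordinate is integrated out, which shifts the restriction
  from \<open>Suc n\<close> to \<open>n\<close> and reproduces the recursion of the power.\<close>

lemma cylinder_prob_last:
  assumes k: "measure_kernel M k" and A: "A \<in> sets M" and x: "x \<in> space M"
  shows "cylinder_prob k (\<lambda>i. if i = n then A else space M) (Suc n) x = kernel_power k (Suc n) x A"
  using x
proof (induction n arbitrary: x)
  case 0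
  then show ?case using A measure_kernelD(1)[OF k] by simp
next
  case (Suc n)
  have "cylinder_prob k (\<lambda>i. if i = Suc n then A else space M) (Suc (Suc n)) x
      = (\<integral>\<^sup>+y. indicator (space M) y *
          cylinder_prob k (\<lambda>i. if i = n then A else space M) (Suc n) y \<partial>k x)"
    by (subst cylinder_prob.simps(2)) simp
  also have "\<dots> = (\<integral>\<^sup>+y. kernel_power k (Suc n) y A \<partial>k x)"
    using measure_kernelD(2)[OF k Suc.prems]
    by (intro nn_integral_cong) (simp add: Suc.IH del: cylinder_prob.simps kernel_power.simps)
  finally show ?case by simp
qed

section \<open>Equal marginals of \<open>\<rho>\<close> and invariance of
  \<open>nu M R\<close>\<close>

lemma borel_measurable_fibre_mass:
  assumes "measure_kernel M R"
  shows "fibre_mass M R \<in> borel_measurable M"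
  unfolding fibre_mass_def using measure_kernelD(3)[OF assms] by simp

lemma nn_integral_transition:
  assumes R: "measure_kernel M R" and x: "x \<in> space M" and f: "f \<in> borel_measurable M"
    and c: "0 < fibre_mass M R x" "fibre_mass M R x < \<infinity>"
  shows "(\<integral>\<^sup>+y. f y \<partial>transition M R x) = inverse (fibre_mass M R x) * (\<integral>\<^sup>+y. f y \<partial>R x)"
  using f c measure_kernelD(1)[OF R x]
  by (simp add: transition_def nn_integral_scale_measure cong: measurable_cong_sets)

text \<open>Symmetry on the rectangles \<open>space M \<times> A\<close> and
  \<open>A \<times> space M\<close> makes the two marginals of \<open>\<rho>\<close> coincide.
  Integrating \<open>f\<close> against the second gives the left side; against the first, the inner
  integrand is constant in \<open>y\<close> and contributes the factor
  \<open>fibre_mass M R x\<close>.\<close>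

lemma nn_integral_symmetric_marginals:
  assumes sym: "symmetric_measure M \<rho>" and dis: "disintegration M \<rho> R"
    and f [measurable]: "f \<in> borel_measurable M"
  shows "(\<integral>\<^sup>+x. \<integral>\<^sup>+y. f y \<partial>R x \<partial>M) = (\<integral>\<^sup>+x. fibre_mass M R x * f x \<partial>M)"
proof -
  have sets_\<rho> [measurable_cong]: "sets \<rho> = sets (M \<Otimes>\<^sub>M M)"
    using sym by (simp add: symmetric_measure_def)
  have space_\<rho>: "space \<rho> = space M \<times> space M"
    using sets_eq_imp_space_eq[OF sets_\<rho>] by (simp add: space_pair_measure)
  have R: "measure_kernel M R"
    and \<rho>: "\<And>g. g \<in> borel_measurable (M \<Otimes>\<^sub>M M) \<Longrightarrow>
      (\<integral>\<^sup>+z. g z \<partial>\<rho>) = (\<integral>\<^sup>+x. \<integral>\<^sup>+y. g (x, y) \<partial>R x \<partial>M)"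
    using dis by (auto simp: disintegration_def)
  have "distr \<rho> M snd = distr \<rho> M fst"
  proof (rule measure_eqI)
    fix A assume "A \<in> sets (distr \<rho> M snd)"
    then have A [measurable]: "A \<in> sets M" by simp
    have "snd -` A \<inter> space \<rho> = space M \<times> A" "fst -` A \<inter> space \<rho> = A \<times> space M"
      using sets.sets_into_space[OF A] by (auto simp: space_\<rho>)
    then show "emeasure (distr \<rho> M snd) A = emeasure (distr \<rho> M fst) A"
      using sym A by (simp add: emeasure_distr symmetric_measure_def)
  qed simp
  then have "(\<integral>\<^sup>+z. f (snd z) \<partial>\<rho>) = (\<integral>\<^sup>+z. f (fst z) \<partial>\<rho>)"
    using nn_integral_distr[of snd \<rho> M f] nn_integral_distr[of fst \<rho> M f] by simp
  then have "(\<integral>\<^sup>+x. \<integral>\<^sup>+y. f y \<partial>R x \<partial>M) = (\<integral>\<^sup>+x. \<integral>\<^sup>+y. f x \<partial>R x \<partial>M)"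
    by (simp add: \<rho>)
  also have "\<dots> = (\<integral>\<^sup>+x. fibre_mass M R x * f x \<partial>M)"
    using measure_kernelD(2)[OF R]
    by (intro nn_integral_cong) (simp add: fibre_mass_def mult.commute)
  finally show ?thesis .
qed

text \<open>Moves an almost-everywhere statement under the kernel, as induction on powers requires:
  the second marginal of \<open>\<rho>\<close> equals the first, which has a density with respect to
  \<open>M\<close>.\<close>

lemma AE_AE_disintegration:
  assumes sym: "symmetric_measure M \<rho>" and dis: "disintegration M \<rho> R"
    and Q: "AE y in M. Q y"
  shows "AE x in M. AE y in R x. Q y"
proof -
  have R: "measure_kernel M R" using dis by (simp add: disintegration_def)
  \<comment> \<open>\<open>Q\<close> may be non-measurable, so its failure set is enclosed in a
    measurable null set.\<close>
  obtain N where N: "{y \<in> space M. \<not> Q y} \<subseteq> N" "emeasure M N = 0" "N \<in> sets M"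
    using Q by (rule AE_E)
  have "(\<integral>\<^sup>+x. emeasure (R x) N \<partial>M) = (\<integral>\<^sup>+x. \<integral>\<^sup>+y. indicator N y \<partial>R x \<partial>M)"
    using N(3) measure_kernelD(1)[OF R] by (intro nn_integral_cong) simp
  also have "\<dots> = (\<integral>\<^sup>+x. fibre_mass M R x * indicator N x \<partial>M)"
    using N(3) by (intro nn_integral_symmetric_marginals[OF sym dis]) simp
  also have "\<dots> = 0"
    using N(2,3) by (intro nn_integral_null_set) (simp add: null_sets_def)
  finally have "AE x in M. emeasure (R x) N = 0"
    using measure_kernelD(3)[OF R N(3)] by (simp add: nn_integral_0_iff_AE)
  then show ?thesis
    using AE_space
  proof eventually_elim
    case (elim x)
    then show ?case
      using N(1,3) measure_kernelD(1,2)[OF R] by (intro AE_I[of _ _ N]) auto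
  qed
qed

text \<open>The density of \<open>nu M R\<close> cancels the normalisation of
  \<open>transition\<close>, leaving the integral against the second marginal of
  \<open>\<rho>\<close>, which is also the first.\<close>

lemma nn_integral_transition_nu:
  assumes sym: "symmetric_measure M \<rho>" and dis: "disintegration M \<rho> R"
    and c: "AE x in M. 0 < fibre_mass M R x \<and> fibre_mass M R x < \<infinity>"
    and f [measurable]: "f \<in> borel_measurable M"
  shows "(\<integral>\<^sup>+x. \<integral>\<^sup>+y. f y \<partial>transition M R x \<partial>nu M R) = (\<integral>\<^sup>+x. f x \<partial>nu M R)"
proof -
  have R: "measure_kernel M R" using dis by (simp add: disintegration_def)
  note [measurable] = borel_measurable_fibre_mass[OF R]
    borel_measurable_nn_integral_measure_kernel[OF
      measure_kernel_prob_algebra[OF measurable_transition[OF R]] f]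
  have "(\<integral>\<^sup>+x. \<integral>\<^sup>+y. f y \<partial>transition M R x \<partial>nu M R)
      = (\<integral>\<^sup>+x. fibre_mass M R x * (\<integral>\<^sup>+y. f y \<partial>transition M R x) \<partial>M)"
    unfolding nu_def by (rule nn_integral_density) measurable
  also have "\<dots> = (\<integral>\<^sup>+x. \<integral>\<^sup>+y. f y \<partial>R x \<partial>M)"
  proof (rule nn_integral_cong_AE)
    show "AE x in M. fibre_mass M R x * (\<integral>\<^sup>+y. f y \<partial>transition M R x) = (\<integral>\<^sup>+y. f y \<partial>R x)"
      using c AE_space
    proof eventually_elim
      case (elim x)
      \<comment> \<open>Both bounds on the fibre mass are used: in \<open>ennreal\<close> this
        product is 0 at 0 and at \<open>\<infinity>\<close>.\<close>
      then have "fibre_mass M R x * inverse (fibre_mass M R x) = 1"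
        by (simp add: zero_less_iff_neq_zero flip: divide_ennreal_def)
      then show ?case
        using elim by (simp add: nn_integral_transition[OF R _ f] flip: mult.assoc)
    qed
  qed
  also have "\<dots> = (\<integral>\<^sup>+x. fibre_mass M R x * f x \<partial>M)"
    by (rule nn_integral_symmetric_marginals[OF sym dis f])
  also have "\<dots> = (\<integral>\<^sup>+x. f x \<partial>nu M R)"
    unfolding nu_def by (rule nn_integral_density[symmetric]) measurable
  finally show ?thesis .
qed

lemma nn_integral_kernel_power_nu:
  assumes sym: "symmetric_measure M \<rho>" and dis: "disintegration M \<rho> R"
    and c: "AE x in M. 0 < fibre_mass M R x \<and> fibre_mass M R x < \<infinity>"
    and A: "A \<in> sets M"
  shows "(\<integral>\<^sup>+x. kernel_power (transition M R) n x A \<partial>nu M R) = emeasure (nu M R) A"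
proof (induction n)
  case 0
  with A show ?case by (simp add: nu_def)
next
  case (Suc n)
  have mk: "measure_kernel M (transition M R)"
    using dis by (simp add: disintegration_def measure_kernel_prob_algebra measurable_transition)
  have "(\<integral>\<^sup>+x. kernel_power (transition M R) (Suc n) x A \<partial>nu M R)
      = (\<integral>\<^sup>+x. \<integral>\<^sup>+y. kernel_power (transition M R) n y A \<partial>transition M R x \<partial>nu M R)"
    using A measure_kernelD(1)[OF mk]
    by (intro nn_integral_cong) (simp add: kernel_power_Suc nu_def)
  with Suc show ?case
    by (simp add: nn_integral_transition_nu[OF sym dis c borel_measurable_kernel_power[OF mk A]])
qed

section \<open>Null sets of the kernels and irreducibility\<close>

lemma kernel_power_pos_iff:
  assumes k: "measure_kernel M k" and x: "x \<in> space M" and A: "A \<in> sets M"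
  shows "0 < kernel_power k (Suc n) x A \<longleftrightarrow> \<not> (AE y in k x. kernel_power k n y A = 0)"
proof -
  have "(\<lambda>y. kernel_power k n y A) \<in> borel_measurable (k x)"
    using borel_measurable_kernel_power[OF k A] measure_kernelD(1)[OF k x]
    by (simp cong: measurable_cong_sets)
  \<comment> \<open>A nonnegative integral vanishes exactly when its integrand is zero almost
    everywhere, so positivity depends on \<open>k x\<close> only through its null sets.\<close>
  then show ?thesis
    using A measure_kernelD(1)[OF k x]
    by (simp add: kernel_power_Suc nn_integral_0_iff_AE zero_less_iff_neq_zero)
qed

text \<open>Here \<open>transition M R x\<close> is \<open>R x\<close> scaled by a nonzero constant,
  which preserves null sets.\<close>

lemma AE_transition_iff:
  assumes R: "measure_kernel M R" and x: "x \<in> space M"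
    and c: "0 < fibre_mass M R x" "fibre_mass M R x < \<infinity>"
  shows "(AE y in transition M R x. Q y) \<longleftrightarrow> (AE y in R x. Q y)"
proof -
  have "inverse (fibre_mass M R x) \<noteq> 0"
    using c by (simp add: less_top)
  then show ?thesis
    using c by (auto simp: eventually_ae_filter null_sets_def transition_def space_scale_measure)
qed

lemma AE_kernel_power_transition_pos_iff:
  assumes sym: "symmetric_measure M \<rho>" and dis: "disintegration M \<rho> R"
    and c: "AE x in M. 0 < fibre_mass M R x \<and> fibre_mass M R x < \<infinity>"
    and A: "A \<in> sets M"
  shows "AE x in M. 0 < kernel_power (transition M R) n x A \<longleftrightarrow> 0 < kernel_power R n x A"
proof (induction n)
  case 0
  show ?case by simp
next
  case (Suc n)
  have R: "measure_kernel M R" using dis by (simp add: disintegration_def)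
  note P = measure_kernel_prob_algebra[OF measurable_transition[OF R]]
  \<comment> \<open>The induction hypothesis holds only for almost every starting point; the next
    power integrates over starting points with respect to \<open>R x\<close>, so it is first turned
    into a statement valid \<open>R x\<close>-almost everywhere.\<close>
  from AE_AE_disintegration[OF sym dis Suc] c AE_space show ?case
  proof eventually_elim
    case (elim x)
    then have "AE y in R x. kernel_power (transition M R) n y A = 0 \<longleftrightarrow> kernel_power R n y A = 0"
      by (simp add: zero_less_iff_neq_zero)
    then have "(AE y in R x. kernel_power (transition M R) n y A = 0) \<longleftrightarrow>
        (AE y in R x. kernel_power R n y A = 0)"
      by (rule eventually_cong)
    with elim show ?case
      by (simp add: kernel_power_pos_iff[OF P _ A] kernel_power_pos_iff[OF R _ A]
          AE_transition_iff[OF R])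
  qed
qed

lemma irreducible_kernel_transition_iff:
  assumes "symmetric_measure M \<rho>" and "disintegration M \<rho> R"
    and "AE x in M. 0 < fibre_mass M R x \<and> fibre_mass M R x < \<infinity>"
  shows "irreducible_kernel M (transition M R) \<longleftrightarrow> irreducible_kernel M R"
proof -
  have "(AE x in M. \<exists>n\<ge>1. 0 < kernel_power (transition M R) n x A) \<longleftrightarrow>
      (AE x in M. \<exists>n\<ge>1. 0 < kernel_power R n x A)" if "A \<in> sets M" for A
  proof (rule eventually_cong)
    \<comment> \<open>The exceptional null set depends on \<open>n\<close>; countably many of them
      still have a null union.\<close>
    show "AE x in M. \<forall>n. 0 < kernel_power (transition M R) n x A \<longleftrightarrow> 0 < kernel_power R n x A"
      using AE_kernel_power_transition_pos_iff[OF assms that] by (simp add: AE_all_countable)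
  qed simp
  then show ?thesis by (simp add: irreducible_kernel_def)
qed

section \<open>Rectangles under \<open>rho_pow\<close> and two-time events on path space\<close>

lemma emeasure_rho_pow_times:
  assumes R: "measure_kernel M R" and A: "A \<in> sets M" and B: "B \<in> sets M"
  shows "emeasure (rho_pow M R (Suc n)) (A \<times> B) =
    (\<integral>\<^sup>+x. indicator A x * kernel_power (transition M R) (Suc n) x B \<partial>nu M R)"
  \<comment> \<open>The section of \<open>A \<times> B\<close> at \<open>x\<close> is
    \<open>B\<close> for \<open>x\<close> in \<open>A\<close> and empty otherwise, where the power
    vanishes.\<close>
  using assms
  by (auto simp: emeasure_rho_pow kernel_power_empty indicator_def intro!: nn_integral_cong
      simp del: kernel_power.simps)

lemma emeasure_path_measure_two_times:
  assumes R: "measure_kernel M R" and A: "A \<in> sets M" and B: "B \<in> sets M"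
  shows "emeasure (path_measure M R) {\<omega> \<in> space (path_space M). \<omega> 0 \<in> A \<and> \<omega> (Suc n) \<in> B} =
    (\<integral>\<^sup>+x. indicator A x * kernel_power (transition M R) (Suc n) x B \<partial>nu M R)"
    (is "emeasure _ ?S = _")
proof (cases "space M = {}")
  \<comment> \<open>The integral formula for \<open>path_measure\<close> requires a nonempty space;
    on an empty one both sides are 0.\<close>
  case True
  then have "?S = {}" by (auto simp: path_space_def space_PiM)
  moreover have "(\<integral>\<^sup>+x. indicator A x * kernel_power (transition M R) (Suc n) x B \<partial>nu M R) = 0"
    using True by (intro nn_integral_empty) (simp add: nu_def)
  ultimately show ?thesis by (simp only: emeasure_empty)
next
  case False
  note P = measurable_transition[OF R]
  let ?B = "\<lambda>i. if i = n then B else space M"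
  \<comment> \<open>The event becomes a cylinder whose sets at times 1 to \<open>n\<close> are the
    whole space; index \<open>n\<close> of \<open>?B\<close> constrains time
    \<open>Suc n\<close>.\<close>
  have S: "?S = {\<omega>\<in>space (path_space M). (\<forall>i<Suc n. \<omega> (Suc i) \<in> ?B i) \<and> \<omega> 0 \<in> A}"
    by (auto simp: path_space_def space_PiM)
  have [measurable]: "(\<lambda>\<omega>. \<omega> i) \<in> path_space M \<rightarrow>\<^sub>M M" for i
    unfolding path_space_def by measurable
  have "?S \<in> sets (path_space M)" using A B by measurable
  then have "emeasure (path_measure M R) ?S =
      (\<integral>\<^sup>+x. emeasure (path_law M (transition M R) x) ?S \<partial>nu M R)"
    using False by (intro emeasure_path_measure R)
  also have "\<dots> = (\<integral>\<^sup>+x. indicator A x * kernel_power (transition M R) (Suc n) x B \<partial>nu M R)"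
  proof (rule nn_integral_cong)
    fix x assume "x \<in> space (nu M R)"
    then have x: "x \<in> space M" by (simp add: nu_def)
    have "emeasure (path_law M (transition M R) x) ?S =
        indicator A x * cylinder_prob (transition M R) ?B (Suc n) x"
      unfolding S using A B by (intro emeasure_path_law[OF P x]) auto
    then show "emeasure (path_law M (transition M R) x) ?S =
        indicator A x * kernel_power (transition M R) (Suc n) x B"
      by (simp only: cylinder_prob_last[OF measure_kernel_prob_algebra[OF P] B x])
  qed
  finally show ?thesis .
qed

section \<open>Square integrability and the inner product\<close>

lemma emeasure_nu_finite:
  assumes "locally_L1 M (fibre_mass M R)" and "A \<in> sets M" "emeasure M A < \<infinity>"
  shows "emeasure (nu M R) A < \<infinity>"
  using assms by (auto simp: locally_L1_def nu_def emeasure_density)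

lemma indicator_in_L2:
  assumes "A \<in> sets N" "emeasure N A < \<infinity>"
  shows "indicator A \<in> L2 N"
proof -
  have "(\<lambda>x. (indicator A x)\<^sup>2) = (indicator A :: 'a \<Rightarrow> real)"
    by (auto simp: indicator_def)
  with assms show ?thesis by (simp add: L2_def less_top)
qed

lemma kernel_op_power_nu:
  assumes sym: "symmetric_measure M \<rho>" and dis: "disintegration M \<rho> R"
    and c: "AE x in M. 0 < fibre_mass M R x \<and> fibre_mass M R x < \<infinity>"
    and A: "A \<in> sets M" "emeasure (nu M R) A < \<infinity>"
  shows integrable_kernel_op_power:
      "integrable (nu M R) ((kernel_op (transition M R) ^^ n) (indicator A))" (is ?I)
    and kernel_op_power_in_L2:
      "(kernel_op (transition M R) ^^ n) (indicator A) \<in> L2 (nu M R)" (is ?L)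
proof -
  let ?h = "(kernel_op (transition M R) ^^ n) (indicator A) :: 'a \<Rightarrow> real"
  have P: "transition M R \<in> M \<rightarrow>\<^sub>M prob_algebra M"
    using dis by (simp add: disintegration_def measurable_transition)
  have [simp]: "space (nu M R) = space M" "sets (nu M R) = sets M" by (simp_all add: nu_def)
  note h = kernel_op_power_indicator[OF P _ A(1), of _ n]
  note le1 = kernel_power_le_1[OF P _ A(1), of _ n]
  have h_enn: "ennreal (?h x) = kernel_power (transition M R) n x A" if "x \<in> space M" for x
    using that by (simp add: h ennreal_enn2real_kernel_power[OF P _ A(1)])
  have h01: "0 \<le> ?h x" "?h x \<le> 1" if "x \<in> space M" for x
    using h[OF that] enn2real_mono[OF le1[OF that]] by auto
  have "?h \<in> borel_measurable M"
    using borel_measurable_kernel_power[OF measure_kernel_prob_algebra[OF P] A(1), of n]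
    by (simp add: h cong: measurable_cong)
  then have [measurable]: "?h \<in> borel_measurable (nu M R)" by (simp add: nu_def)
  \<comment> \<open>Invariance keeps the total integral equal to the measure of \<open>A\<close>,
    whose finiteness yields integrability.\<close>
  have "(\<integral>\<^sup>+x. ennreal (?h x) \<partial>nu M R) = emeasure (nu M R) A"
    using nn_integral_kernel_power_nu[OF sym dis c A(1), of n]
      nn_integral_cong[of "nu M R" "\<lambda>x. ennreal (?h x)"] h_enn
    by simp
  with A(2) h01 show I: ?I by (intro integrableI_nonneg AE_I2) auto
  have "integrable (nu M R) (\<lambda>x. (?h x)\<^sup>2)"
  proof (rule Bochner_Integration.integrable_bound[OF I])
    \<comment> \<open>Values in the unit interval make the square at most the function
      itself.\<close>
    show "AE x in nu M R. norm ((?h x)\<^sup>2) \<le> norm (?h x)"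
      using h01 by (intro AE_I2) (simp add: power2_eq_square mult_left_le)
  qed measurable
  then show ?L by (simp add: L2_def)
qed

lemma L2_inner_kernel_op_power:
  assumes sym: "symmetric_measure M \<rho>" and dis: "disintegration M \<rho> R"
    and c: "AE x in M. 0 < fibre_mass M R x \<and> fibre_mass M R x < \<infinity>"
    and A: "A \<in> sets M" and B: "B \<in> sets M" "emeasure (nu M R) B < \<infinity>"
  shows "ennreal (L2_inner (nu M R) (indicator A)
      ((kernel_op (transition M R) ^^ n) (indicator B))) =
    (\<integral>\<^sup>+x. indicator A x * kernel_power (transition M R) n x B \<partial>nu M R)"
proof -
  let ?h = "(kernel_op (transition M R) ^^ n) (indicator B) :: 'a \<Rightarrow> real"
  have P: "transition M R \<in> M \<rightarrow>\<^sub>M prob_algebra M"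
    using dis by (simp add: disintegration_def measurable_transition)
  note h = kernel_op_power_indicator[OF P _ B(1), of _ n]
  \<comment> \<open>Integrability is inherited from \<open>?h\<close>. It rules out the default
    value 0 of the Bochner integral, so the real inner product agrees with the nonnegative
    integral.\<close>
  have "integrable (nu M R) (\<lambda>x. indicator A x * ?h x)"
    using integrable_real_mult_indicator[OF _ integrable_kernel_op_power[OF sym dis c B, of n]] A
    by (subst mult.commute) (simp add: nu_def)
  then have "ennreal (L2_inner (nu M R) (indicator A) ?h) = (\<integral>\<^sup>+x. ennreal (indicator A x * ?h x) \<partial>nu M R)"
    unfolding L2_inner_def using h
    by (intro nn_integral_eq_integral[symmetric]) (auto simp: nu_def)
  also have "\<dots> = (\<integral>\<^sup>+x. indicator A x * kernel_power (transition M R) n x B \<partial>nu M R)"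
  proof (rule nn_integral_cong)
    fix x assume "x \<in> space (nu M R)"
    then have x: "x \<in> space M" by (simp add: nu_def)
    then have "ennreal (?h x) = kernel_power (transition M R) n x B"
      by (simp add: h ennreal_enn2real_kernel_power[OF P _ B(1)])
    then show "ennreal (indicator A x * ?h x) =
        indicator A x * kernel_power (transition M R) n x B"
      by (simp add: indicator_def)
  qed
  finally show ?thesis .
qed

theorem theorem6p2:
  fixes \<mu> :: "'a measure"
    and \<rho> :: "('a \<times> 'a) measure"
    and R :: "'a \<Rightarrow> 'a measure"
  assumes "standard_borel \<mu>"
    and "sigma_finite_measure \<mu>"
    and "non_atomic \<mu>"
    and "symmetric_measure \<mu> \<rho>"
    and "disintegration \<mu> \<rho> R"
    and "AE x in \<mu>. 0 < fibre_mass \<mu> R x \<and> fibre_mass \<mu> R x < \<infinity>"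
    and "locally_L1 \<mu> (fibre_mass \<mu> R)"
  shows "(\<forall>A\<in>sets \<mu>. \<forall>B\<in>sets \<mu>. emeasure \<mu> A < \<infinity> \<longrightarrow> emeasure \<mu> B < \<infinity> \<longrightarrow>
           (\<forall>n\<ge>1.
              indicator A \<in> L2 (nu \<mu> R) \<and>
              (kernel_op (transition \<mu> R) ^^ n) (indicator B) \<in> L2 (nu \<mu> R) \<and>
              emeasure (rho_pow \<mu> R n) (A \<times> B) =
                ennreal (L2_inner (nu \<mu> R) (indicator A)
                  ((kernel_op (transition \<mu> R) ^^ n) (indicator B))) \<and>
              ennreal (L2_inner (nu \<mu> R) (indicator A)
                  ((kernel_op (transition \<mu> R) ^^ n) (indicator B))) =
                emeasure (path_measure \<mu> R)
                  {\<omega> \<in> space (path_space \<mu>). \<omega> 0 \<in> A \<and> \<omega> n \<in> B})) \<and>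
         (irreducible_kernel \<mu> (transition \<mu> R) \<longleftrightarrow> irreducible_kernel \<mu> R)"
proof (intro conjI ballI impI allI)
  have R: "measure_kernel \<mu> R" using assms(5) by (simp add: disintegration_def)
  note sym = assms(4) and dis = assms(5) and c = assms(6)
  show "irreducible_kernel \<mu> (transition \<mu> R) \<longleftrightarrow> irreducible_kernel \<mu> R"
    by (rule irreducible_kernel_transition_iff[OF sym dis c])
  fix A B and n :: nat
  assume A: "A \<in> sets \<mu>" "emeasure \<mu> A < \<infinity>" and B: "B \<in> sets \<mu>" "emeasure \<mu> B < \<infinity>"
    and "1 \<le> n"
  then obtain m where n: "n = Suc m" by (cases n) auto
  \<comment> \<open>Local integrability of the fibre mass turns \<open>\<mu>\<close>-finite sets
    into \<open>nu\<close>-finite ones.\<close>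
  note \<nu>A = emeasure_nu_finite[OF assms(7) A] and \<nu>B = emeasure_nu_finite[OF assms(7) B]
  note inner = L2_inner_kernel_op_power[OF sym dis c A(1) B(1) \<nu>B, of n]
  show "indicator A \<in> L2 (nu \<mu> R)"
    using A(1) \<nu>A by (intro indicator_in_L2) (simp_all add: nu_def)
  show "(kernel_op (transition \<mu> R) ^^ n) (indicator B) \<in> L2 (nu \<mu> R)"
    by (rule kernel_op_power_in_L2[OF sym dis c B(1) \<nu>B])
  show "emeasure (rho_pow \<mu> R n) (A \<times> B) =
      ennreal (L2_inner (nu \<mu> R) (indicator A)
        ((kernel_op (transition \<mu> R) ^^ n) (indicator B)))"
    \<comment> \<open>All quantities meet in the integral of \<open>kernel_power\<close> over
      \<open>A\<close>. Since \<open>inner\<close> is stated for \<open>n\<close>, it is rewritten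
      before \<open>n\<close> is replaced by \<open>Suc m\<close>.\<close>
    unfolding inner unfolding n by (rule emeasure_rho_pow_times[OF R A(1) B(1)])
  show "ennreal (L2_inner (nu \<mu> R) (indicator A)
        ((kernel_op (transition \<mu> R) ^^ n) (indicator B))) =
      emeasure (path_measure \<mu> R) {\<omega> \<in> space (path_space \<mu>). \<omega> 0 \<in> A \<and> \<omega> n \<in> B}"
    unfolding inner unfolding n
    by (rule emeasure_path_measure_two_times[OF R A(1) B(1), symmetric])
qed

end
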